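(* Let $\mathcal{E}=(e_1,\dots,e_n)$ be an ordered set of $n$ elements, let $\mathcal{F}\subseteq 2^{\mathcal{E}}$ be a family of subsets, and let $Z_{\mathcal{F}}$ be a zero-suppressed binary decision diagram (ZDD) characterizing $\mathcal{F}$. Let $A\in\mathcal{F}$. Then the RestrictSet procedure (described in the context), run on $Z_{\mathcal{F}}$ and $A$, modifies $Z_{\mathcal{F}}$ in $O(n)$ time and produces a ZDD $Z_{\mathcal{F}'}$ characterizing $\mathcal{F}'=\mathcal{F}\setminus\{A\}$. Furthermore, $|Z_{\mathcal{F}'}|\le |Z_{\mathcal{F}}|+3n$.
   Context: A ZDD over the ordered set $\mathcal{E}=(e_1,\dots,e_n)$ is a directed acyclic graph $Z$ with: two special terminal nodes $\mathbf{1}$ (true) and $\mathbf{0}$ (false) with no outgoing edges; a unique root $r$ (indegree $0$, first in topological order); every other node $a$ has exactly two outgoing edges, a high edge to its high child $\mathrm{hi}(a)$ and a low edge to its low child $\mathrm{lo}(a)$, and is labeled with an index $\mathrm{var}(a)\in\{1,\dots,n\}$, with the convention $\mathrm{var}(\mathbf{1})=\mathrm{var}(\mathbf{0})=n+1$, and $\mathrm{var}(\mathrm{hi}(a))>\mathrm{var}(a)$, $\mathrm{var}(\mathrm{lo}(a))>\mathrm{var}(a)$; no node has $\mathrm{hi}(a)=\mathbf{0}$. The indegree $\delta^-(a)$ is the number of incoming edges of $a$. A set $A\subseteq\mathcal{E}$ induces a path $P_A$ from $r$: at a current non-terminal node $a$, go to $\mathrm{hi}(a)$ if $e_{\mathrm{var}(a)}\in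 A$ and to $\mathrm{lo}(a)$ otherwise, until a terminal is reached. $Z$ accepts $A$ if $P_A$ ends at $\mathbf{1}$ and no edge $(a,b)$ on $P_A$ skips an element of $A$, i.e. $\{e_{\mathrm{var}(a)+1},\dots,e_{\mathrm{var}(b)-1}\}\cap A=\emptyset$ for every edge $(a,b)$ of $P_A$; otherwise $Z$ rejects $A$. $Z$ characterizes $\mathcal{F}$ if it accepts exactly the sets in $\mathcal{F}$. The size $|Z|$ is the number of nodes plus the number of edges of $Z$. RestrictSet$(Z_{\mathcal{F}},A)$, with $(\alpha_1,\dots,\alpha_n)$ the characteristic vector of $A$: (1) Set $a=r$. While $\delta^-(a)<2$ and $a\notin\{\mathbf{1},\mathbf{0}\}$: set $b=a$, and move $a$ to $\mathrm{hi}(a)$ if $\alpha_{\mathrm{var}(a)}=1$, else to $\mathrm{lo}(a)$. (The node $c=a$ reached is the split node, $b$ its parent on $P_A$.) (2) Continuing from $a=c$ along $P_A$ until a terminal is reached, record the visited non-terminal nodes in a list. (3) Set $a'=\mathbf{0}$; for each node $a$ in the list in reverse order, insert a new node with label $\mathrm{var}(a)$ whose low child is $\mathrm{lo}(a)$ and high child is $a'$ if $\alpha_{\mathrm{var}(a)}=1$, or whose low child is $a'$ and high child is $\mathrm{hi}(a)$ if $\alpha_{\mathrm{var}(a)}=0$, and let $a'$ be this new node (indegrees of children are updated). (4) If $\alpha_{\mathrm{var}(b)}=1$ redirect the high edge of $b$ to $a'$, else redirect the low edge of $b$ to $a'$. Each node insertion is assumed to take (average) constant time.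
   Formalization: The output of RestrictSet may have one high edge into 0 (the last edge of A's path); it is otherwise a ZDD, and deletions within the O(n) bound make it one. Elements before the root's label count as skipped; if the root is a terminal, the root itself is redirected. *)

theory Defs
  imports Complex_Main "HOL-Library.Landau_Symbols" "HOL-Library.While_Combinator"
    "HOL-Library.Monad_Syntax"
begin

(* Bot and Top are the terminals 0 (false) and 1 (true). Both belong to every diagram, even when
   no edge enters them. Non-terminal nodes are named by natural numbers. *)
datatype node = Bot | Top | Inner nat

(* The fields var, hi and lo are only meaningful on the set inner. *)
record diagram =
  inner :: "nat set"
  var :: "nat \<Rightarrow> nat"
  hi :: "nat \<Rightarrow> node"
  lo :: "nat \<Rightarrow> node"
  root_node :: node

definition nodes :: "diagram \<Rightarrow> node set" where
  "nodes Z = {Bot, Top} \<union> Inner ` inner Z"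

definition child :: "diagram \<Rightarrow> nat \<Rightarrow> bool \<Rightarrow> node" where
  "child Z i h = (if h then hi Z i else lo Z i)"

(* Edges carry a high/low tag, so that two parallel edges are counted as two. *)
definition edges :: "diagram \<Rightarrow> (nat \<times> bool \<times> node) set" where
  "edges Z = {(i, h, child Z i h) | i h. i \<in> inner Z}"

definition indeg :: "diagram \<Rightarrow> node \<Rightarrow> nat" where
  "indeg Z v = card {(i, h, w) \<in> edges Z. w = v}"

definition zdd_size :: "diagram \<Rightarrow> nat" where
  "zdd_size Z = card (nodes Z) + card (edges Z)"

fun level :: "nat \<Rightarrow> diagram \<Rightarrow> node \<Rightarrow> nat" where
  "level n Z (Inner i) = var Z i"
| "level n Z Bot = n + 1"
| "level n Z Top = n + 1"

(* All the conditions on a ZDD except zero-suppression. Acyclicity follows from the ordering of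
   the labels. The root may be a terminal, and then there are no non-terminal nodes. *)
definition ordered_diagram :: "nat \<Rightarrow> diagram \<Rightarrow> bool" where
  "ordered_diagram n Z \<longleftrightarrow>
     finite (inner Z) \<and>
     root_node Z \<in> nodes Z \<and>
     indeg Z (root_node Z) = 0 \<and>
     (\<forall>i\<in>inner Z. indeg Z (Inner i) = 0 \<longrightarrow> root_node Z = Inner i) \<and>
     (\<forall>i\<in>inner Z. var Z i \<in> {1..n}) \<and>
     (\<forall>i\<in>inner Z. hi Z i \<in> nodes Z \<and> lo Z i \<in> nodes Z) \<and>
     (\<forall>i\<in>inner Z. level n Z (hi Z i) > var Z i \<and> level n Z (lo Z i) > var Z i)"

definition zero_suppressed :: "diagram \<Rightarrow> bool" where
  "zero_suppressed Z \<longleftrightarrow> (\<forall>i\<in>inner Z. hi Z i \<noteq> Bot)"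

definition zdd :: "nat \<Rightarrow> diagram \<Rightarrow> bool" where
  "zdd n Z \<longleftrightarrow> ordered_diagram n Z \<and> zero_suppressed Z"

(* Below, e i is the i-th element of the ordered ground set, for i from 1 to n. *)

definition follow :: "(nat \<Rightarrow> 'a) \<Rightarrow> diagram \<Rightarrow> 'a set \<Rightarrow> nat \<Rightarrow> node" where
  "follow e Z A i = child Z i (e (var Z i) \<in> A)"

inductive path :: "(nat \<Rightarrow> 'a) \<Rightarrow> diagram \<Rightarrow> 'a set \<Rightarrow> node \<Rightarrow> node list \<Rightarrow> bool"
  for e Z A where
  path_Bot: "path e Z A Bot [Bot]"
| path_Top: "path e Z A Top [Top]"
| path_Inner: "path e Z A (follow e Z A i) p \<Longrightarrow> path e Z A (Inner i) (Inner i # p)"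

(* The elements e j with l < j < u *)
definition between :: "(nat \<Rightarrow> 'a) \<Rightarrow> nat \<Rightarrow> nat \<Rightarrow> 'a set" where
  "between e l u = e ` {l<..<u}"

(* The elements before the label of the root count as skipped, as on an edge into the root
   from level 0. *)
definition accepts :: "nat \<Rightarrow> (nat \<Rightarrow> 'a) \<Rightarrow> diagram \<Rightarrow> 'a set \<Rightarrow> bool" where
  "accepts n e Z A \<longleftrightarrow>
     (\<exists>p. path e Z A (root_node Z) p \<and> last p = Top \<and>
       between e 0 (level n Z (root_node Z)) \<inter> A = {} \<and>
       (\<forall>k. Suc k < length p \<longrightarrow>
          between e (level n Z (p ! k)) (level n Z (p ! Suc k)) \<inter> A = {}))"

definition characterizes :: "nat \<Rightarrow> (nat \<Rightarrow> 'a) \<Rightarrow> diagram \<Rightarrow> 'a set set \<Rightarrow> bool" where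
  "characterizes n e Z F \<longleftrightarrow> {A. A \<subseteq> e ` {1..n} \<and> accepts n e Z A} = F"

(* RestrictSet. Each phase also returns a number of steps: every loop iteration, node insertion
   and redirection of an edge is one step. In-degrees are taken to be stored with the nodes, so
   that reading one, or updating those of the children of an inserted node, takes constant time.
   The result is None if a loop does not terminate. *)

definition find_split ::
    "(nat \<Rightarrow> 'a) \<Rightarrow> diagram \<Rightarrow> 'a set \<Rightarrow> (node \<times> nat option \<times> nat) option" where
  "find_split e Z A =
     while_option
       (\<lambda>(a, b, t). indeg Z a < 2 \<and> a \<notin> {Top, Bot})
       (\<lambda>(a, b, t). case a of
            Inner i \<Rightarrow> (follow e Z A i, Some i, t + 1)
          | _ \<Rightarrow> (a, b, t))
       (root_node Z, None, 0)"

definition record_path ::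
    "(nat \<Rightarrow> 'a) \<Rightarrow> diagram \<Rightarrow> 'a set \<Rightarrow> node \<Rightarrow> (node \<times> nat list \<times> nat) option" where
  "record_path e Z A c =
     while_option
       (\<lambda>(a, xs, t). a \<notin> {Top, Bot})
       (\<lambda>(a, xs, t). case a of
            Inner i \<Rightarrow> (follow e Z A i, xs @ [i], t + 1)
          | _ \<Rightarrow> (a, xs, t))
       (c, [], 0)"

definition insert_node :: "nat \<Rightarrow> node \<Rightarrow> node \<Rightarrow> diagram \<Rightarrow> diagram \<times> node" where
  "insert_node v l h Z =
     (let k = (LEAST k. k \<notin> inner Z) in
       (Z\<lparr>inner := insert k (inner Z), var := (var Z)(k := v),
          lo := (lo Z)(k := l), hi := (hi Z)(k := h)\<rparr>, Inner k))"

definition copy_node ::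
    "(nat \<Rightarrow> 'a) \<Rightarrow> 'a set \<Rightarrow> nat \<Rightarrow> diagram \<times> node \<times> nat \<Rightarrow> diagram \<times> node \<times> nat" where
  "copy_node e A i = (\<lambda>(Z, a', t).
     let (Z', k) = (if e (var Z i) \<in> A
                    then insert_node (var Z i) (lo Z i) a' Z
                    else insert_node (var Z i) a' (hi Z i) Z)
     in (Z', k, t + 1))"

definition redirect :: "nat \<Rightarrow> bool \<Rightarrow> node \<Rightarrow> diagram \<Rightarrow> diagram" where
  "redirect i h v Z =
     (if h then Z\<lparr>hi := (hi Z)(i := v)\<rparr> else Z\<lparr>lo := (lo Z)(i := v)\<rparr>)"

(* If the root is a terminal, the split node has no parent and the root itself is redirected. *)
definition restrict_set ::
    "(nat \<Rightarrow> 'a) \<Rightarrow> diagram \<Rightarrow> 'a set \<Rightarrow> (diagram \<times> nat) option" where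
  "restrict_set e Z A =
     do {
       (c, b, t1) \<leftarrow> find_split e Z A;
       (_, xs, t2) \<leftarrow> record_path e Z A c;
       let (Z1, a', t3) = fold (copy_node e A) (rev xs) (Z, Bot, 0);
       let Z2 = (case b of
                   Some i \<Rightarrow> redirect i (e (var Z1 i) \<in> A) a' Z1
                 | None \<Rightarrow> Z1\<lparr>root_node := a'\<rparr>);
       Some (Z2, t1 + t2 + t3 + 1)
     }"

(* RestrictSet can create one high edge into Bot, for instance on the family {{e 1}}. The usual
   ZDD deletion rule removes such a node. The bound on the in-degree makes it constant-time. *)

definition delete_node :: "nat \<Rightarrow> diagram \<Rightarrow> diagram" where
  "delete_node i Z =
     (let r = (\<lambda>v. if v = Inner i then lo Z i else v) in
       Z\<lparr>inner := inner Z - {i}, hi := r \<circ> hi Z, lo := r \<circ> lo Z,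
         root_node := r (root_node Z)\<rparr>)"

definition suppress_step :: "diagram \<Rightarrow> diagram \<Rightarrow> bool" where
  "suppress_step Z Z' \<longleftrightarrow>
     (\<exists>i\<in>inner Z. hi Z i = Bot \<and> indeg Z (Inner i) \<le> 1 \<and> Z' = delete_node i Z)"

end

(*
  Every node before the split node on the path of A has in-degree at most 1, so an input set
  whose path uses the redirected edge follows A down to that edge. After it, the input runs
  through the copies, which differ from the recorded nodes only in their successor along A, and
  falls back into the old diagram with unchanged acceptance as soon as it leaves the path of A.
  Only an input whose whole path is that of A ends in the final Bot, and such an input was
  accepted before only if it is A. Labels increase along paths, so at most n nodes are copied.

  High edges into Bot occur only on the new path of A, whose nodes have in-degree at most 1.
  Deleting such a node can only turn its parent, again on this path, into another one, so at
  most n deletions restore zero-suppression.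
*)

theory Submission
  imports Defs
begin

section \<open>Size, in-degrees and the root, read off single edges\<close>

section \<open>Edges, in-degrees and levels\<close>

lemma edges_iff: "(i, h, v) \<in> edges Z \<longleftrightarrow> i \<in> inner Z \<and> v = child Z i h"
  by (auto simp: edges_def)

lemma edges_image: "edges Z = (\<lambda>(i, h). (i, h, child Z i h)) ` (inner Z \<times> UNIV)"
  by (auto simp: edges_def)

lemma finite_edges: "finite (inner Z) \<Longrightarrow> finite (edges Z)"
  by (simp add: edges_image)

text \<open>Every inner node brings itself and two tagged edges, hence the factor 3, which is also
  that of the final size bound; the 2 counts the terminals.\<close>

lemma zdd_size_eq:
  assumes "finite (inner Z)"
  shows "zdd_size Z = 2 + 3 * card (inner Z)"
proof -
  have "card (nodes Z) = card {Bot, Top} + card (Inner ` inner Z)"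
    unfolding nodes_def using assms by (intro card_Un_disjoint) auto
  also have "card (Inner ` inner Z) = card (inner Z)"
    by (intro card_image) (auto simp: inj_on_def)
  finally have "card (nodes Z) = 2 + card (inner Z)"
    by simp
  moreover have "card (edges Z) = card (inner Z \<times> (UNIV :: bool set))"
    unfolding edges_image by (intro card_image) (auto simp: inj_on_def)
  ultimately show ?thesis
    by (simp add: zdd_size_def card_cartesian_product)
qed

lemma finite_edges_into: "finite (inner Z) \<Longrightarrow> finite {(i, h, w) \<in> edges Z. w = v}"
  by (rule finite_subset[OF _ finite_edges]) auto

lemma indeg_eq_0_iff:
  "finite (inner Z) \<Longrightarrow> indeg Z v = 0 \<longleftrightarrow> (\<forall>i\<in>inner Z. \<forall>h. child Z i h \<noteq> v)"
  using finite_edges_into[of Z v] by (auto simp: indeg_def edges_iff)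

text \<open>Incoming edges are compared by source and tag, so two parallel edges already violate
  uniqueness.\<close>

lemma indeg_le_1_iff:
  assumes "finite (inner Z)"
  shows "indeg Z v \<le> 1 \<longleftrightarrow>
    (\<forall>i\<in>inner Z. \<forall>j\<in>inner Z. \<forall>h k. child Z i h = v \<longrightarrow> child Z j k = v \<longrightarrow> i = j \<and> h = k)"
proof -
  have "indeg Z v \<le> 1 \<longleftrightarrow> (\<forall>x\<in>{(i, h, w) \<in> edges Z. w = v}. \<forall>y\<in>{(i, h, w) \<in> edges Z. w = v}. x = y)"
    unfolding indeg_def using card_le_Suc0_iff_eq[OF finite_edges_into[OF assms, of v]] by simp
  then show ?thesis
    by (simp only: Ball_def split_paired_All mem_Collect_eq case_prod_conv edges_iff prod.inject) blast
qed

lemma ordered_diagramD: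
  assumes "ordered_diagram n Z"
  shows "finite (inner Z)" "root_node Z \<in> nodes Z" "indeg Z (root_node Z) = 0"
    "i \<in> inner Z \<Longrightarrow> indeg Z (Inner i) = 0 \<Longrightarrow> root_node Z = Inner i"
    "i \<in> inner Z \<Longrightarrow> 1 \<le> var Z i" "i \<in> inner Z \<Longrightarrow> var Z i \<le> n"
    "i \<in> inner Z \<Longrightarrow> child Z i h \<in> nodes Z"
    "i \<in> inner Z \<Longrightarrow> var Z i < level n Z (child Z i h)"
  using assms by (auto simp: ordered_diagram_def child_def)

lemma ordered_diagramI:
  assumes "finite (inner Z)" "root_node Z \<in> nodes Z"
    and "\<And>i h. i \<in> inner Z \<Longrightarrow> child Z i h \<noteq> root_node Z"
    and "\<And>i. i \<in> inner Z \<Longrightarrow> root_node Z \<noteq> Inner i \<Longrightarrow> \<exists>j\<in>inner Z. \<exists>h. child Z j h = Inner i"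
    and "\<And>i. i \<in> inner Z \<Longrightarrow> var Z i \<in> {1..n}"
    and child: "\<And>i h. i \<in> inner Z \<Longrightarrow> child Z i h \<in> nodes Z \<and> var Z i < level n Z (child Z i h)"
  shows "ordered_diagram n Z"
proof -
  have "hi Z i \<in> nodes Z \<and> var Z i < level n Z (hi Z i)"
    "lo Z i \<in> nodes Z \<and> var Z i < level n Z (lo Z i)" if "i \<in> inner Z" for i
    using child[OF that, of True] child[OF that, of False] by (simp_all add: child_def)
  moreover have "root_node Z = Inner i" if "i \<in> inner Z" "indeg Z (Inner i) = 0" for i
    using assms(4)[OF that(1)] that(2) by (auto simp: indeg_eq_0_iff[OF assms(1)])
  moreover have "indeg Z (root_node Z) = 0"
    using assms(3) by (simp add: indeg_eq_0_iff[OF assms(1)])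
  ultimately show ?thesis
    unfolding ordered_diagram_def using assms(1,2,5) by simp
qed

text \<open>Labels strictly increase along edges, so no edge enters a node of least label, and an
  inner node without incoming edges is the root.\<close>

lemma root_if_least_var:
  assumes ord: "ordered_diagram n Z" and i: "i \<in> inner Z"
    and least: "\<And>j. j \<in> inner Z \<Longrightarrow> var Z i \<le> var Z j"
  shows "root_node Z = Inner i"
proof -
  have "child Z j h \<noteq> Inner i" if "j \<in> inner Z" for j h
    using ordered_diagramD(8)[OF ord that, of h] least[OF that] by auto
  then show ?thesis
    using ordered_diagramD(1,4)[OF ord] i by (auto simp: indeg_eq_0_iff)
qed

lemma level_root_pos:
  assumes "ordered_diagram n Z"
  shows "0 < level n Z (root_node Z)"
  using ordered_diagramD(2,5)[OF assms] by (auto simp: nodes_def Suc_le_eq)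

section \<open>Acceptance as a recursion over the nodes\<close>

section \<open>Acceptance from a node\<close>

text \<open>\<open>l\<close> is the level from which the node is entered, so the skipping condition
  of the incoming edge is part of the recursion. \<open>Bot\<close> has no rule because it never
  accepts.\<close>

inductive accepts_from :: "nat \<Rightarrow> (nat \<Rightarrow> 'a) \<Rightarrow> diagram \<Rightarrow> 'a set \<Rightarrow> nat \<Rightarrow> node \<Rightarrow> bool"
  for n e Z B where
  Top: "between e l (n + 1) \<inter> B = {} \<Longrightarrow> accepts_from n e Z B l Top"
| Inner: "between e l (var Z i) \<inter> B = {} \<Longrightarrow> accepts_from n e Z B (var Z i) (follow e Z B i) \<Longrightarrow>
    accepts_from n e Z B l (Inner i)"

inductive_simps accepts_from_simps [simp]:
  "accepts_from n e Z B l Bot"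
  "accepts_from n e Z B l Top"
  "accepts_from n e Z B l (Inner i)"

lemma path_Cons: "path e Z A v p \<Longrightarrow> \<exists>q. p = v # q"
  by (erule path.cases) auto

lemma accepts_from_iff_path:
  "accepts_from n e Z B l v \<longleftrightarrow>
     (\<exists>p. path e Z B v p \<and> last p = Top \<and> between e l (level n Z v) \<inter> B = {} \<and>
       (\<forall>k. Suc k < length p \<longrightarrow>
          between e (level n Z (p ! k)) (level n Z (p ! Suc k)) \<inter> B = {}))"
  (is "_ \<longleftrightarrow> (\<exists>p. ?R l v p)")
proof
  show "\<exists>p. ?R l v p" if "accepts_from n e Z B l v"
    using that
  proof induction
    case (Top l)
    then show ?case
      by (intro exI[of _ "[Top]"]) (auto intro: path_Top)
  next
    case (Inner l i)
    then obtain p where p: "?R (var Z i) (follow e Z B i) p"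
      by blast
    obtain q where q: "p = follow e Z B i # q"
      using p path_Cons by blast
    have "between e (level n Z ((Inner i # p) ! k)) (level n Z ((Inner i # p) ! Suc k)) \<inter> B = {}"
      if "Suc k < length (Inner i # p)" for k
      using p that by (cases k) (auto simp: q)
    then have "?R l (Inner i) (Inner i # p)"
      using p Inner.hyps(1) by (auto simp: q intro: path_Inner)
    then show ?case
      by blast
  qed
next
  have "accepts_from n e Z B l v" if "path e Z B v p" "?R l v p" for p
    using that
  proof (induction arbitrary: l)
    case (path_Inner i p)
    obtain q where q: "p = follow e Z B i # q"
      using path_Inner.hyps path_Cons by blast
    have "between e (level n Z (p ! k)) (level n Z (p ! Suc k)) \<inter> B = {}" if "Suc k < length p" for k
    proof -
      have "Suc (Suc k) < length (Inner i # p)"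
        using that by simp
      then have "between e (level n Z ((Inner i # p) ! Suc k)) (level n Z ((Inner i # p) ! Suc (Suc k))) \<inter> B = {}"
        using path_Inner.prems by blast
      then show ?thesis
        by simp
    qed
    moreover have "between e (var Z i) (level n Z (follow e Z B i)) \<inter> B = {}"
      using path_Inner.prems by (force simp: q)
    ultimately have "accepts_from n e Z B (var Z i) (follow e Z B i)"
      using path_Inner.prems path_Inner.hyps by (intro path_Inner.IH) (auto simp: q)
    then show ?case
      using path_Inner.prems by simp
  qed auto
  then show "accepts_from n e Z B l v" if "\<exists>p. ?R l v p"
    using that by blast
qed

lemma accepts_iff: "accepts n e Z B \<longleftrightarrow> accepts_from n e Z B 0 (root_node Z)"
  unfolding accepts_def accepts_from_iff_path ..

lemma between_split:
  assumes "l < m" "m < u"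
  shows "between e l u = between e l m \<union> {e m} \<union> between e m u"
proof -
  have "{l<..<u} = {l<..<m} \<union> {m} \<union> {m<..<u}"
    using assms by auto
  then show ?thesis
    by (simp add: between_def image_Un)
qed

text \<open>An edge can be cut at a level \<open>m\<close> that it skips. This relates an edge
  passing over a deleted node to the edge that used to enter it.\<close>

lemma accepts_from_split:
  assumes "l < m" "m < level n Z v"
  shows "accepts_from n e Z B l v \<longleftrightarrow>
    between e l m \<inter> B = {} \<and> e m \<notin> B \<and> accepts_from n e Z B m v"
  using assms by (cases v) (auto simp: between_split[of l m])

text \<open>\<open>S\<close> is closed under children and the diagrams agree on it, so a run that
  starts in \<open>S\<close> never sees a difference.\<close>

lemma accepts_from_transfer:
  assumes "accepts_from n e Z B l v" "v \<in> S"
    and "\<And>i h. Inner i \<in> S \<Longrightarrow> var Z' i = var Z i \<and> child Z' i h = child Z i h \<and> child Z i h \<in> S"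
  shows "accepts_from n e Z' B l v"
  using assms(1,2) by induction (use assms(3) in \<open>auto simp: follow_def\<close>)

lemma accepts_from_cong:
  assumes "v \<in> S"
    and "\<And>i h. Inner i \<in> S \<Longrightarrow> var Z' i = var Z i \<and> child Z' i h = child Z i h \<and> child Z i h \<in> S"
  shows "accepts_from n e Z' B l v \<longleftrightarrow> accepts_from n e Z B l v"
  using accepts_from_transfer[of n e Z B l v S Z'] accepts_from_transfer[of n e Z' B l v S Z] assms
  by metis

section \<open>The deletion rule: ordering and accepted sets are kept\<close>

section \<open>Deleting nodes whose high edge enters \<open>Bot\<close>\<close>

lemma child_delete_node:
  "child (delete_node i Z) j h = (if child Z j h = Inner i then lo Z i else child Z j h)"
  by (simp add: child_def delete_node_def Let_def)

lemma delete_node_simps [simp]: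
  "inner (delete_node i Z) = inner Z - {i}"
  "var (delete_node i Z) = var Z"
  "root_node (delete_node i Z) = (if root_node Z = Inner i then lo Z i else root_node Z)"
  by (simp_all add: delete_node_def Let_def)

lemma level_delete_node [simp]: "level n (delete_node i Z) v = level n Z v"
  by (cases v) auto

context
  fixes n Z i
  assumes ord: "ordered_diagram n Z" and i: "i \<in> inner Z" and hi_Bot: "hi Z i = Bot"
begin

lemma lo_facts: "lo Z i \<in> nodes Z" "var Z i < level n Z (lo Z i)" "lo Z i \<noteq> Inner i"
  using ordered_diagramD(7,8)[OF ord i, of False] by (auto simp: child_def)

lemma ordered_diagram_delete_node: "ordered_diagram n (delete_node i Z)"
proof (rule ordered_diagramI)
  show "finite (inner (delete_node i Z))"
    using ordered_diagramD(1)[OF ord] by simp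
  show "root_node (delete_node i Z) \<in> nodes (delete_node i Z)"
    using ordered_diagramD(2)[OF ord] lo_facts by (auto simp: nodes_def)
  show "var (delete_node i Z) j \<in> {1..n}" if "j \<in> inner (delete_node i Z)" for j
    using that ordered_diagramD(5,6)[OF ord] by simp
  show "child (delete_node i Z) j h \<in> nodes (delete_node i Z) \<and>
      var (delete_node i Z) j < level n (delete_node i Z) (child (delete_node i Z) j h)"
    if "j \<in> inner (delete_node i Z)" for j h
    using that ordered_diagramD(7,8)[OF ord, of j h] lo_facts
    by (auto simp: child_delete_node nodes_def)
  show "child (delete_node i Z) j h \<noteq> root_node (delete_node i Z)"
    if j: "j \<in> inner (delete_node i Z)" for j h
  proof (cases "root_node Z = Inner i")
    case True
    \<comment> \<open>The low child of the deleted root becomes the root and must have no other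
      parent. A remaining node of least label can only have had the parent \<open>i\<close>, whose
      high edge enters \<open>Bot\<close>, so it is this low child.\<close>
    define k where "k = arg_min_on (var Z) (inner Z - {i})"
    have fin: "finite (inner Z - {i})" and ne: "inner Z - {i} \<noteq> {}"
      using ordered_diagramD(1)[OF ord] j by auto
    have k: "k \<in> inner Z" "k \<noteq> i"
      using arg_min_if_finite(1)[OF fin ne, of "var Z"] by (auto simp: k_def)
    have least: "var Z k \<le> var Z q" if "q \<in> inner Z - {i}" for q
      using arg_min_least[OF fin ne that, of "var Z"] by (simp add: k_def)
    obtain q g where q: "q \<in> inner Z" "child Z q g = Inner k"
      using ordered_diagramD(4)[OF ord k(1)] True k(2)
      by (auto simp: indeg_eq_0_iff[OF ordered_diagramD(1)[OF ord]])
    have "q = i"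
      using ordered_diagramD(8)[OF ord q(1), of g] least[of q] q by auto
    then have lo: "lo Z i = Inner k"
      using q hi_Bot by (auto simp: child_def split: if_splits)
    have "child Z j h \<noteq> Inner k" "child Z j h \<noteq> Inner i"
      using ordered_diagramD(8)[OF ord, of j h] least[of j] j ordered_diagramD(1,3)[OF ord] True
      by (auto simp: indeg_eq_0_iff)
    then show ?thesis
      using True lo by (simp add: child_delete_node)
  next
    case False
    have "child Z q g \<noteq> root_node Z" if "q \<in> inner Z" for q g
      using ordered_diagramD(1,3)[OF ord] that by (simp add: indeg_eq_0_iff)
    from this[of j h] this[of i False] show ?thesis
      using False i j unfolding child_delete_node by (simp add: child_def)
  qed
  show "\<exists>q\<in>inner (delete_node i Z). \<exists>h. child (delete_node i Z) q h = Inner j"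
    if j: "j \<in> inner (delete_node i Z)" and "root_node (delete_node i Z) \<noteq> Inner j" for j
  proof -
    have indeg: "\<exists>q\<in>inner Z. \<exists>h. child Z q h = Inner k"
      if "k \<in> inner Z" "root_node Z \<noteq> Inner k" for k
      using ordered_diagramD(4)[OF ord that(1)] that(2)
      by (auto simp: indeg_eq_0_iff[OF ordered_diagramD(1)[OF ord]])
    have "root_node Z \<noteq> Inner j"
      using that by (auto split: if_splits)
    then obtain q h where q: "q \<in> inner Z" "child Z q h = Inner j"
      using indeg[of j] j by auto
    show ?thesis
    proof (cases "q = i")
      case False
      then show ?thesis
        using q j by (intro bexI[of _ q] exI[of _ h]) (auto simp: child_delete_node)
    next
      case True
      \<comment> \<open>Since \<open>j\<close> is not the new root, \<open>i\<close> was not the old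
        one; so \<open>i\<close> has a parent, which inherits the low edge to
        \<open>j\<close>.\<close>
      then have lo: "lo Z i = Inner j"
        using q hi_Bot by (auto simp: child_def split: if_splits)
      then have "root_node Z \<noteq> Inner i"
        using that by auto
      then obtain p g where p: "p \<in> inner Z" "child Z p g = Inner i"
        using indeg[of i] i by auto
      moreover have "p \<noteq> i"
        using ordered_diagramD(8)[OF ord p(1), of g] p by auto
      ultimately show ?thesis
        using lo by (intro bexI[of _ p] exI[of _ g]) (auto simp: child_delete_node)
    qed
  qed
qed

text \<open>A set containing \<open>e (var Z i)\<close> is led into \<open>Bot\<close>; for any
  other set, going through \<open>i\<close> to its low child is the same as skipping the level of
  \<open>i\<close>.\<close>

lemma accepts_from_hi_Bot:
  assumes "l < var Z i"
  shows "accepts_from n e Z B l (Inner i) \<longleftrightarrow> accepts_from n e Z B l (lo Z i)"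
  using accepts_from_split[OF assms lo_facts(2), of e B]
  by (auto simp: follow_def child_def hi_Bot)

lemma follow_delete_node:
  "follow e (delete_node i Z) B j = (if follow e Z B j = Inner i then lo Z i else follow e Z B j)"
  by (simp add: follow_def child_delete_node)

lemma follow_facts:
  "j \<in> inner Z \<Longrightarrow> follow e Z B j \<in> nodes Z \<and> var Z j < level n Z (follow e Z B j)"
  using ordered_diagramD(7,8)[OF ord] by (simp add: follow_def)

lemma accepts_from_delete_nodeD:
  assumes "accepts_from n e Z B l v" "v \<in> nodes Z" "l < level n Z v"
  shows "accepts_from n e (delete_node i Z) B l (if v = Inner i then lo Z i else v)"
  using assms
proof induction
  case (Inner l j)
  have j: "j \<in> inner Z"
    using Inner.prems by (auto simp: nodes_def)
  have IH: "accepts_from n e (delete_node i Z) B (var Z j) (follow e (delete_node i Z) B j)"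
    using Inner.IH follow_facts[OF j, of e B] by (simp add: follow_delete_node)
  show ?case
  proof (cases "j = i")
    case False
    then show ?thesis
      using Inner.hyps IH by simp
  next
    case True
    \<comment> \<open>Acceptance through \<open>i\<close> rules out its high edge, so the level of
      \<open>i\<close> can be merged into the skipped interval.\<close>
    have "e (var Z i) \<notin> B"
      using Inner.hyps(2) by (auto simp: follow_def child_def True hi_Bot)
    then show ?thesis
      using IH Inner.hyps(1) Inner.prems lo_facts
        accepts_from_split[of l "var Z i" n "delete_node i Z" "lo Z i" e B]
      by (simp add: True follow_delete_node) (simp add: follow_def child_def)
  qed
qed auto

lemma accepts_from_delete_node_imp:
  assumes "accepts_from n e (delete_node i Z) B l v" "v \<in> nodes Z" "v \<noteq> Inner i" "l < level n Z v"
  shows "accepts_from n e Z B l v"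
  using assms
proof induction
  case (Inner l j)
  have j: "j \<in> inner Z"
    using Inner.prems by (auto simp: nodes_def)
  have "accepts_from n e Z B (var Z j) (follow e Z B j)"
  proof (cases "follow e Z B j = Inner i")
    \<comment> \<open>The edge into \<open>i\<close> has become an edge into \<open>lo Z i\<close>,
      and \<open>accepts_from_hi_Bot\<close> puts \<open>i\<close> back.\<close>
    case True
    have "var Z j < var Z i"
      using follow_facts[OF j, of e B] by (simp add: True)
    then show ?thesis
      using Inner.IH lo_facts by (simp only: True accepts_from_hi_Bot) (simp add: True follow_delete_node)
  next
    case False
    then show ?thesis
      using Inner.IH follow_facts[OF j, of e B] by (simp add: follow_delete_node)
  qed
  then show ?case
    using Inner.hyps by simp
qed auto

lemma accepts_from_delete_node:
  assumes "v \<in> nodes Z" "l < level n Z v"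
  shows "accepts_from n e (delete_node i Z) B l (if v = Inner i then lo Z i else v) \<longleftrightarrow>
    accepts_from n e Z B l v"
proof (cases "v = Inner i")
  case True
  then show ?thesis
    using assms accepts_from_delete_nodeD[of e B l v] accepts_from_delete_node_imp[of e B l "lo Z i"]
      accepts_from_hi_Bot[of l e B] lo_facts by auto
next
  case False
  then show ?thesis
    using assms accepts_from_delete_nodeD[of e B l v] accepts_from_delete_node_imp[of e B l v] by auto
qed

lemma accepts_delete_node: "accepts n e (delete_node i Z) B \<longleftrightarrow> accepts n e Z B"
  using accepts_from_delete_node[OF ordered_diagramD(2)[OF ord] level_root_pos[OF ord], of e B]
  by (simp add: accepts_iff)

end

text \<open>\<open>P\<close> is closed under parents, its nodes have in-degree at most 1, and it
  contains every node with a high edge into \<open>Bot\<close>. After a deletion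
  \<open>P - {i}\<close> has the same properties, so \<open>card P\<close> bounds the number of
  deletions.\<close>

lemma suppress_all:
  assumes "ordered_diagram n Z" "P \<subseteq> inner Z"
    and "\<And>i j h. i \<in> inner Z \<Longrightarrow> child Z i h = Inner j \<Longrightarrow> j \<in> P \<Longrightarrow> i \<in> P"
    and "\<And>i. i \<in> P \<Longrightarrow> indeg Z (Inner i) \<le> 1"
    and "\<And>i. i \<in> inner Z \<Longrightarrow> hi Z i = Bot \<Longrightarrow> i \<in> P"
  shows "\<exists>k Z'. k \<le> card P \<and> (suppress_step ^^ k) Z Z' \<and> zdd n Z' \<and>
    (\<forall>B. accepts n e Z' B \<longleftrightarrow> accepts n e Z B) \<and> zdd_size Z' \<le> zdd_size Z"
  using assms
proof (induction "card P" arbitrary: P Z)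
  case 0
  have "P = {}"
    using 0 finite_subset[OF \<open>P \<subseteq> inner Z\<close>] ordered_diagramD(1)[OF \<open>ordered_diagram n Z\<close>] by simp
  then have "zdd n Z"
    using 0 by (auto simp: zdd_def zero_suppressed_def)
  then show ?case
    by (intro exI[of _ "0 :: nat"] exI[of _ Z]) simp
next
  case (Suc m)
  note ord = \<open>ordered_diagram n Z\<close>
  note fin = ordered_diagramD(1)[OF ord]
  show ?case
  proof (cases "\<exists>i\<in>inner Z. hi Z i = Bot")
    case False
    then have "zdd n Z"
      using ord by (auto simp: zdd_def zero_suppressed_def)
    then show ?thesis
      by (intro exI[of _ "0 :: nat"] exI[of _ Z]) simp
  next
    case True
    then obtain i where i: "i \<in> inner Z" "hi Z i = Bot"
      by blast
    define D where "D = delete_node i Z"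
    have iP: "i \<in> P"
      using Suc.prems(5) i .
    have finP: "finite P"
      using finite_subset[OF Suc.prems(2) fin] .
    have uniq: "p = q \<and> g = h"
      if "p \<in> inner Z" "q \<in> inner Z" "child Z p g = Inner j" "child Z q h = Inner j" "j \<in> P"
      for p q g h j
      using Suc.prems(4)[OF \<open>j \<in> P\<close>] that indeg_le_1_iff[OF fin] by blast
    have child_D: "child D q h = v \<longleftrightarrow> child Z q h = v \<and> v \<noteq> Inner i \<or> child Z q h = Inner i \<and> lo Z i = v"
      for q h v
      using lo_facts(3)[OF ord i] by (auto simp: D_def child_delete_node)
    have D: "\<exists>k Z'. k \<le> card (P - {i}) \<and> (suppress_step ^^ k) D Z' \<and> zdd n Z' \<and>
        (\<forall>B. accepts n e Z' B \<longleftrightarrow> accepts n e D B) \<and> zdd_size Z' \<le> zdd_size D"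
    proof (rule Suc.hyps(1))
      show "m = card (P - {i})"
        using Suc.hyps(2) iP finP by simp
      show "ordered_diagram n D"
        unfolding D_def by (rule ordered_diagram_delete_node[OF ord i])
      show "P - {i} \<subseteq> inner D"
        using Suc.prems(2) by (auto simp: D_def)
      show "q \<in> P - {i}" if "q \<in> inner D" "child D q h = Inner j" "j \<in> P - {i}" for q j h
        using that Suc.prems(3) iP by (auto simp: child_D) (auto simp: D_def)
      \<comment> \<open>An edge of \<open>D\<close> into \<open>j\<close> is an old edge into
        \<open>j\<close>, or an old edge into \<open>i\<close> continued by the low edge of
        \<open>i\<close>. Uniqueness of the edges into \<open>i\<close> and \<open>j\<close> in
        \<open>Z\<close> leaves at most one.\<close>
      show "indeg D (Inner j) \<le> 1" if j: "j \<in> P - {i}" for j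
      proof -
        have "p = q \<and> g = h"
          if "p \<in> inner D" "q \<in> inner D" "child D p g = Inner j" "child D q h = Inner j" for p q g h
        proof -
          have *: "p \<in> inner Z" "q \<in> inner Z" "p \<noteq> i" "q \<noteq> i"
            using that by (auto simp: D_def)
          have "child Z i False = lo Z i"
            by (simp add: child_def)
          then show ?thesis
            using that(3,4) uniq[OF *(1,2)] uniq[OF *(1) i(1)] uniq[OF *(2) i(1)] * j iP
            unfolding child_D by (metis DiffD1)
        qed
        moreover have "finite (inner D)"
          using fin by (simp add: D_def)
        ultimately show ?thesis
          using indeg_le_1_iff[of D "Inner j"] by blast
      qed
      show "q \<in> P - {i}" if "q \<in> inner D" "hi D q = Bot" for q
      proof -
        have "child D q True = Bot"
          using that by (simp add: child_def)
        \<comment> \<open>A new high edge into \<open>Bot\<close> can only belong to a parent of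
          \<open>i\<close>, and such a parent is in \<open>P\<close>.\<close>
        then have "hi Z q = Bot \<or> child Z q True = Inner i"
          unfolding child_D by (auto simp: child_def)
        then show ?thesis
          using that(1) Suc.prems(3,5) iP by (auto simp: D_def)
      qed
    qed
    then obtain k Z' where k: "k \<le> card (P - {i})" "(suppress_step ^^ k) D Z'" "zdd n Z'"
      "\<forall>B. accepts n e Z' B \<longleftrightarrow> accepts n e D B" "zdd_size Z' \<le> zdd_size D"
      by blast
    have "suppress_step Z D"
      unfolding suppress_step_def D_def using i Suc.prems(4)[OF iP] by blast
    then have "(suppress_step ^^ Suc k) Z Z'"
      using k(2) by (rule relpowp_Suc_I2)
    moreover have "Suc k \<le> card P"
      using k(1) iP finP Suc.hyps(2) by simp
    moreover have "\<forall>B. accepts n e Z' B \<longleftrightarrow> accepts n e Z B"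
      using k(4) accepts_delete_node[OF ord i] unfolding D_def by blast
    moreover have "zdd_size D \<le> zdd_size Z"
      using fin card_mono[of "inner Z" "inner Z - {i}"] by (simp add: zdd_size_eq D_def)
    then have "zdd_size Z' \<le> zdd_size Z"
      using k(5) by linarith
    ultimately show ?thesis
      using k(3) by blast
  qed
qed

section \<open>Paths that may stop at any node\<close>

section \<open>The path of a set as a list of non-terminal nodes\<close>

text \<open>The end \<open>w\<close> is arbitrary and kept apart from the list, so a path can be cut
  at the split node.\<close>

fun trail :: "(nat \<Rightarrow> 'a) \<Rightarrow> diagram \<Rightarrow> 'a set \<Rightarrow> node \<Rightarrow> nat list \<Rightarrow> node \<Rightarrow> bool" where
  "trail e Z A v [] w \<longleftrightarrow> v = w"
| "trail e Z A v (i # xs) w \<longleftrightarrow> v = Inner i \<and> trail e Z A (follow e Z A i) xs w"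

lemma trail_append:
  "trail e Z A v (xs @ ys) w \<longleftrightarrow> (\<exists>u. trail e Z A v xs u \<and> trail e Z A u ys w)"
  by (induction xs arbitrary: v) auto

lemma trail_start: "trail e Z A v xs w \<Longrightarrow> v = (if xs = [] then w else Inner (hd xs))"
  by (cases xs) auto

lemma trail_nth:
  "trail e Z A v xs w \<Longrightarrow> t < length xs \<Longrightarrow>
    follow e Z A (xs ! t) = (if Suc t < length xs then Inner (xs ! Suc t) else w)"
proof (induction xs arbitrary: v t)
  case (Cons i xs)
  then show ?case
    using trail_start[of e Z A "follow e Z A i" xs w] by (cases t) (auto simp: hd_conv_nth)
qed simp

lemma trail_cong:
  "trail e Z A v xs w \<Longrightarrow> (\<And>i. i \<in> set xs \<Longrightarrow> follow e Z' A i = follow e Z A i) \<Longrightarrow>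
    trail e Z' A v xs w"
  by (induction xs arbitrary: v) auto

lemma trail_path: "trail e Z A v xs Bot \<Longrightarrow> path e Z A v (map Inner xs @ [Bot])"
  by (induction xs arbitrary: v) (auto intro: path.intros)

lemma accepts_from_trail: "accepts_from n e Z A l v \<Longrightarrow> \<exists>xs. trail e Z A v xs Top"
proof (induction rule: accepts_from.induct)
  case (Top l)
  show ?case
    by (rule exI[of _ "[]"]) simp
next
  case (Inner l i)
  then obtain xs where "trail e Z A (follow e Z A i) xs Top"
    by blast
  then show ?case
    by (intro exI[of _ "i # xs"]) simp
qed

text \<open>Each step raises the level by at least one, so nodes do not repeat and their number is
  at most the rise in level. From the root to \<open>Top\<close> this is at most
  \<open>n\<close>.\<close>

lemma trail_ordered:
  assumes "ordered_diagram n Z" "trail e Z A v xs w" "v \<in> nodes Z"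
  shows "set xs \<subseteq> inner Z \<and> distinct xs \<and> length xs + level n Z v \<le> level n Z w \<and>
    (\<forall>j\<in>set xs. level n Z v \<le> var Z j)"
  using assms(2,3)
proof (induction xs arbitrary: v)
  case (Cons i xs)
  have i: "i \<in> inner Z"
    using Cons.prems by (auto simp: nodes_def)
  have "follow e Z A i \<in> nodes Z" "var Z i < level n Z (follow e Z A i)"
    using ordered_diagramD(7,8)[OF assms(1) i] by (simp_all add: follow_def)
  then show ?case
    using Cons.IH[of "follow e Z A i"] Cons.prems i by fastforce
qed simp

text \<open>A later node of \<open>us\<close> is entered from its predecessor along
  \<open>A\<close>, and in-degree at most 1 leaves room for no second edge; the first node is the
  root and is not entered at all.\<close>

lemma child_into_trail:
  assumes ord: "ordered_diagram n Z" and tr: "trail e Z A (root_node Z) us w"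
    and indeg: "\<And>i. i \<in> set us \<Longrightarrow> indeg Z (Inner i) \<le> 1"
    and i: "i \<in> set us" and j: "j \<in> inner Z" "child Z j h = Inner i"
  shows "j \<in> set us \<and> h = (e (var Z j) \<in> A)"
proof -
  note fin = ordered_diagramD(1)[OF ord]
  obtain u1 u2 where us: "us = u1 @ i # u2"
    using i by (auto dest: split_list)
  then have tr1: "trail e Z A (root_node Z) u1 (Inner i)"
    using tr by (auto simp: trail_append)
  show ?thesis
  proof (cases u1 rule: rev_cases)
    case Nil
    then show ?thesis
      using tr1 j ordered_diagramD(3)[OF ord] by (auto simp: indeg_eq_0_iff[OF fin])
  next
    case (snoc u q)
    then have "child Z q (e (var Z q) \<in> A) = Inner i"
      using tr1 by (auto simp: trail_append follow_def)
    moreover have "q \<in> inner Z"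
      using trail_ordered[OF ord tr ordered_diagramD(2)[OF ord]] us snoc by auto
    ultimately have "j = q \<and> h = (e (var Z q) \<in> A)"
      using indeg[OF i] j indeg_le_1_iff[OF fin] by blast
    then show ?thesis
      using us snoc by auto
  qed
qed

section \<open>Acceptance when a path is diverted from \<open>Top\<close> to
  \<open>Bot\<close>\<close>

section \<open>Rerouting a path to \<open>Bot\<close>\<close>

text \<open>\<open>k\<close> acts as a copy of \<open>i\<close>: both share the edge that
  \<open>A\<close> does not take, and the edge that \<open>A\<close> takes is left open.\<close>

definition twin :: "(nat \<Rightarrow> 'a) \<Rightarrow> diagram \<Rightarrow> diagram \<Rightarrow> 'a set \<Rightarrow> nat \<Rightarrow> nat \<Rightarrow> bool" where
  "twin e Z Z' A i k \<longleftrightarrow> var Z' k = var Z i \<and>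
     child Z' k (e (var Z i) \<notin> A) = child Z i (e (var Z i) \<notin> A)"

text \<open>The runs of \<open>B\<close> in both diagrams stay at corresponding nodes until
  \<open>B\<close> and \<open>A\<close> disagree at a label of the path; there both move to the same
  node, with equal acceptance by assumption. Only indices above \<open>l\<close> matter, since the
  earlier part of \<open>B\<close> has been read.\<close>

lemma accepts_from_twins:
  assumes ord: "ordered_diagram n Z"
    and "trail e Z A v xs Top" "trail e Z' A v' ys Bot" "list_all2 (twin e Z Z' A) xs ys"
    and "set xs \<subseteq> inner Z"
    and "\<And>i l. i \<in> set xs \<Longrightarrow> accepts_from n e Z' B l (child Z i (e (var Z i) \<notin> A)) \<longleftrightarrow>
      accepts_from n e Z B l (child Z i (e (var Z i) \<notin> A))"
    and "accepts_from n e Z A l v" "l < level n Z v"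
  shows "accepts_from n e Z' B l v' \<longleftrightarrow>
    accepts_from n e Z B l v \<and> (\<exists>j\<in>{l<..n}. (e j \<in> A) \<noteq> (e j \<in> B))"
  using assms(2-)
proof (induction xs arbitrary: ys v v' l)
  case Nil
  \<comment> \<open>If \<open>B\<close> is accepted at \<open>Top\<close> from level
    \<open>l\<close>, it has no element above \<open>l\<close>. The same holds for \<open>A\<close>,
    so no index tells them apart.\<close>
  then show ?case
    by (fastforce simp: between_def)
next
  case (Cons i xs)
  then obtain k ys' where ys: "ys = k # ys'" and tw: "twin e Z Z' A i k"
    "list_all2 (twin e Z Z' A) xs ys'"
    by (auto simp: list_all2_Cons1)
  define m where "m = var Z i"
  have v: "v = Inner i" "v' = Inner k"
    using Cons.prems(1,2) ys by auto
  have m: "l < m" "m \<le> n" "m < level n Z (follow e Z A i)"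
    using Cons.prems(4,7) ordered_diagramD(6,8)[OF ord, of i] by (auto simp: m_def v follow_def)
  have var_k: "var Z' k = m"
    using tw(1) by (simp add: twin_def m_def)
  have A: "between e l m \<inter> A = {}" "accepts_from n e Z A m (follow e Z A i)"
    using Cons.prems(6) by (simp_all add: v m_def)
  show ?case
  proof (cases "(e m \<in> A) = (e m \<in> B)")
    case True
    have fol: "follow e Z' B k = follow e Z' A k" "follow e Z B i = follow e Z A i"
      using True by (simp_all add: follow_def var_k flip: m_def)
    have "accepts_from n e Z' B m (follow e Z' A k) \<longleftrightarrow>
        accepts_from n e Z B m (follow e Z A i) \<and> (\<exists>j\<in>{m<..n}. (e j \<in> A) \<noteq> (e j \<in> B))"
      by (rule Cons.IH[of _ _ ys']) (use Cons.prems ys tw A m in auto)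
    \<comment> \<open>Elements strictly between \<open>l\<close> and \<open>m\<close> are in neither
      set and the sets agree at \<open>m\<close>, so any disagreement lies above
      \<open>m\<close>.\<close>
    moreover have "(\<exists>j\<in>{l<..n}. (e j \<in> A) \<noteq> (e j \<in> B)) \<longleftrightarrow> (\<exists>j\<in>{m<..n}. (e j \<in> A) \<noteq> (e j \<in> B))"
      if "between e l m \<inter> B = {}"
    proof -
      have "(e j \<in> A) = (e j \<in> B)" if "l < j" "j \<le> m" for j
        using that A(1) \<open>between e l m \<inter> B = {}\<close> True
        by (cases "j = m") (auto simp: between_def disjoint_iff)
      then show ?thesis
        using m(1) by (metis greaterThanAtMost_iff leI less_trans)
    qed
    ultimately show ?thesis
      by (auto simp: v var_k fol simp flip: m_def)
  next
    case False
    then have "follow e Z' B k = child Z i (e m \<notin> A)" "follow e Z B i = child Z i (e m \<notin> A)"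
      using tw(1) by (auto simp: follow_def twin_def m_def)
    moreover have "\<exists>j\<in>{l<..n}. (e j \<in> A) \<noteq> (e j \<in> B)"
      using False m by (intro bexI[of _ m]) auto
    ultimately show ?thesis
      using Cons.prems(5)[of i m] by (simp add: v var_k flip: m_def)
  qed
qed

text \<open>
  The diagram \<open>Z'\<close> is the output of RestrictSet on \<open>Z\<close>. The path of \<open>A\<close> in \<open>Z\<close> is cut at the split
  node into \<open>us\<close> and \<open>zs\<close>, and \<open>ks\<close> are the copies of \<open>zs\<close>. Thus \<open>last us\<close> is the parent whose edge
  is redirected.
\<close>
locale reroute =
  fixes n :: nat and e :: "nat \<Rightarrow> 'a" and Z Z' :: diagram and A :: "'a set" and us zs ks :: "nat list"
  assumes zdd: "zdd n Z"
    and trail: "trail e Z A (root_node Z) (us @ zs) Top"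
    and indeg_us: "i \<in> set us \<Longrightarrow> indeg Z (Inner i) \<le> 1"
    and indeg_zs: "zs \<noteq> [] \<Longrightarrow> 2 \<le> indeg Z (Inner (hd zs))"
    and inner': "inner Z' = inner Z \<union> set ks"
    and fresh: "set ks \<inter> inner Z = {}" and distinct_ks: "distinct ks"
    and var': "i \<in> inner Z \<Longrightarrow> var Z' i = var Z i"
    and child': "i \<in> inner Z \<Longrightarrow> us = [] \<or> i \<noteq> last us \<or> h \<noteq> (e (var Z i) \<in> A) \<Longrightarrow>
      child Z' i h = child Z i h"
    and trail': "trail e Z' A (root_node Z') (us @ ks) Bot"
    and twins_zs: "list_all2 (twin e Z Z' A) zs ks"
    and root': "us \<noteq> [] \<Longrightarrow> root_node Z' = root_node Z"
begin

section \<open>The diagram after rerouting: structure, acceptance, size\<close>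

lemma ordered: "ordered_diagram n Z"
  using zdd by (simp add: zdd_def)

lemma child_neq_Bot: "i \<in> inner Z \<Longrightarrow> child Z i True \<noteq> Bot"
  using zdd by (simp add: zdd_def zero_suppressed_def child_def)

lemma fin: "finite (inner Z)"
  using ordered_diagramD(1)[OF ordered] .

lemma on_trail: "set us \<subseteq> inner Z" "set zs \<subseteq> inner Z" "distinct (us @ zs)" "length (us @ zs) \<le> n"
  using trail_ordered[OF ordered trail ordered_diagramD(2)[OF ordered]] level_root_pos[OF ordered]
  by auto

lemma distinct': "distinct (us @ ks)"
  using on_trail fresh distinct_ks by auto

lemma length': "length ks = length zs"
  using list_all2_lengthD[OF twins_zs] by simp

text \<open>A node of \<open>us\<close> is its own twin, since at most its edge along
  \<open>A\<close> changes.\<close>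

lemma twins: "list_all2 (twin e Z Z' A) (us @ zs) (us @ ks)"
proof -
  have "list_all2 (twin e Z Z' A) us us"
    using on_trail(1) var' child' by (intro list.rel_refl_strong) (auto simp: twin_def)
  then show ?thesis
    using twins_zs by (rule list_all2_appendI)
qed

lemma level': "v \<in> nodes Z \<Longrightarrow> level n Z' v = level n Z v"
  using var' by (auto simp: nodes_def)

lemma nodes': "nodes Z' = nodes Z \<union> Inner ` set ks"
  using inner' by (auto simp: nodes_def)

lemma trail'_nth:
  "t < length (us @ ks) \<Longrightarrow> follow e Z' A ((us @ ks) ! t) =
    (if Suc t < length (us @ ks) then Inner ((us @ ks) ! Suc t) else Bot)"
  by (rule trail_nth[OF trail'])

lemma follow':
  assumes "j \<in> set (us @ ks)"
  shows "follow e Z' A j \<in> nodes Z'" "var Z' j \<in> {1..n}" "var Z' j < level n Z' (follow e Z' A j)"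
proof -
  obtain t where t: "t < length (us @ ks)" "j = (us @ ks) ! t"
    using assms by (metis in_set_conv_nth)
  have var_nth: "var Z' ((us @ ks) ! t) = var Z ((us @ zs) ! t)" if "t < length (us @ ks)" for t
    using list_all2_nthD2[OF twins that] by (simp add: twin_def)
  have nth_inner: "(us @ zs) ! t \<in> inner Z"
    using on_trail(1,2) t(1) length' nth_mem[of t "us @ zs"] by auto
  have nth_inner': "(us @ ks) ! s \<in> inner Z'" if "s < length (us @ ks)" for s
    using nth_mem[OF that] on_trail(1) inner' by auto
  show "follow e Z' A j \<in> nodes Z'"
    using trail'_nth[OF t(1)] nth_inner'[of "Suc t"] by (auto simp: t(2) nodes_def)
  show "var Z' j \<in> {1..n}"
    using var_nth[OF t(1)] ordered_diagramD(5,6)[OF ordered nth_inner] by (simp add: t(2))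
  \<comment> \<open>Equal positions of the old and the new path carry equal labels, and the ends
    \<open>Top\<close> and \<open>Bot\<close> have the same level, so the increase of labels is
    inherited.\<close>
  have "var Z ((us @ zs) ! t) < level n Z (follow e Z A ((us @ zs) ! t))"
    using ordered_diagramD(8)[OF ordered nth_inner] by (simp add: follow_def)
  also have "follow e Z A ((us @ zs) ! t) =
      (if Suc t < length (us @ ks) then Inner ((us @ zs) ! Suc t) else Top)"
    using trail_nth[OF trail, of t] t(1) length' by simp
  also have "level n Z \<dots> = level n Z' (follow e Z' A j)"
    using trail'_nth[OF t(1)] var_nth[of "Suc t"] by (simp only: t(2)) simp
  finally show "var Z' j < level n Z' (follow e Z' A j)"
    using var_nth[OF t(1)] by (simp add: t(2))
qed

text \<open>An edge of \<open>Z'\<close> lies on the new path of \<open>A\<close> or reproduces an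
  edge of \<open>Z\<close>. The last clause of \<open>old\<close> records that an edge reproduced
  from another node is one that \<open>A\<close> does not follow.\<close>

lemma child'_cases:
  assumes "j \<in> inner Z'"
  obtains (on) "j \<in> set (us @ ks)" "h = (e (var Z' j) \<in> A)" "child Z' j h = follow e Z' A j"
  | (old) i where "i \<in> inner Z" "var Z' j = var Z i" "child Z' j h = child Z i h"
      "i = j \<or> h \<noteq> (e (var Z i) \<in> A)"
proof (cases "j \<in> set (us @ ks) \<and> h = (e (var Z' j) \<in> A)")
  case True
  then show ?thesis
    using on by (auto simp: follow_def)
next
  case False
  show ?thesis
  proof (cases "j \<in> inner Z")
    case True
    have "us = [] \<or> j \<noteq> last us \<or> h \<noteq> (e (var Z j) \<in> A)"
      using False var'[OF True] by auto
    then show ?thesis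
      using old[of j] True var' child' by auto
  next
    case notin: False
    then have "j \<in> set ks"
      using assms inner' by auto
    then obtain i where i: "i \<in> set zs" "twin e Z Z' A i j"
      using twins_zs by (metis in_set_conv_nth list_all2_conv_all_nth)
    then have "h = (e (var Z i) \<notin> A)"
      using False \<open>j \<in> set ks\<close> by (auto simp: twin_def)
    then show ?thesis
      using old[of i] i on_trail(2) by (auto simp: twin_def)
  qed
qed

text \<open>A reproduced edge cannot enter a fresh copy. If it enters \<open>us\<close>, it follows
  \<open>A\<close> in \<open>Z\<close>, so by the last clause of \<open>old\<close> it still starts
  at its original source.\<close>

lemma child_into_trail':
  assumes "j \<in> inner Z'" "child Z' j h = Inner k" "k \<in> set (us @ ks)"
  shows "j \<in> set (us @ ks) \<and> h = (e (var Z' j) \<in> A)"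
  using assms(1)
proof (cases rule: child'_cases[of j h])
  case (old i)
  then have "Inner k \<in> nodes Z"
    using ordered_diagramD(7)[OF ordered, of i h] assms(2) by simp
  then have "k \<in> set us"
    using assms(3) fresh by (auto simp: nodes_def)
  moreover obtain u where "trail e Z A (root_node Z) us u"
    using trail by (auto simp: trail_append)
  ultimately show ?thesis
    using child_into_trail[OF ordered _ indeg_us, of e A us u k i h] old assms(2) by auto
qed simp

lemma indeg':
  assumes "k \<in> set (us @ ks)"
  shows "indeg Z' (Inner k) \<le> 1"
proof -
  have "p = q \<and> g = h"
    if pq: "p \<in> inner Z'" "q \<in> inner Z'" "child Z' p g = Inner k" "child Z' q h = Inner k" for p q g h
  proof -
    have p: "p \<in> set (us @ ks)" "g = (e (var Z' p) \<in> A)"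
      and q: "q \<in> set (us @ ks)" "h = (e (var Z' q) \<in> A)"
      using child_into_trail' pq assms by auto
    obtain s t where s: "s < length (us @ ks)" "p = (us @ ks) ! s"
      and t: "t < length (us @ ks)" "q = (us @ ks) ! t"
      using p(1) q(1) by (metis in_set_conv_nth)
    have "follow e Z' A p = Inner k" "follow e Z' A q = Inner k"
      using pq(3,4) p(2) q(2) by (simp_all add: follow_def)
    then have "Suc s < length (us @ ks) \<and> Suc t < length (us @ ks) \<and> (us @ ks) ! Suc s = (us @ ks) ! Suc t"
      using trail'_nth[OF s(1)] trail'_nth[OF t(1)] by (auto simp only: s(2) t(2) node.inject node.distinct split: if_splits)
    then have "Suc s = Suc t"
      using nth_eq_iff_index_eq[OF distinct'] by blast
    then show ?thesis
      using s t p q by simp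
  qed
  moreover have "finite (inner Z')"
    using fin inner' by simp
  ultimately show ?thesis
    using indeg_le_1_iff by blast
qed

text \<open>Reproduced edges inherit zero-suppression from \<open>Z\<close>, so only the final edge
  of the new path can be a high edge into \<open>Bot\<close>.\<close>

lemma hi_Bot':
  assumes "j \<in> inner Z'" "hi Z' j = Bot"
  shows "e (var Z' j) \<in> A" "us @ ks \<noteq> []" "j = last (us @ ks)"
proof -
  have Bot: "child Z' j True = Bot"
    using assms(2) by (simp add: child_def)
  have "j \<in> set (us @ ks) \<and> e (var Z' j) \<in> A \<and> follow e Z' A j = Bot"
    using assms(1)
  proof (cases rule: child'_cases[of j True])
    case on
    then show ?thesis
      using Bot by simp
  next
    case (old i)
    then show ?thesis
      using Bot child_neq_Bot[of i] by simp
  qed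
  then obtain t where t: "t < length (us @ ks)" "j = (us @ ks) ! t" "e (var Z' j) \<in> A" "follow e Z' A j = Bot"
    by (metis in_set_conv_nth)
  then have "\<not> Suc t < length (us @ ks)"
    using trail'_nth[OF t(1)] by (auto simp only: node.distinct split: if_splits)
  then have "t = length (us @ ks) - 1"
    using t(1) by simp
  then show "e (var Z' j) \<in> A" "us @ ks \<noteq> []" "j = last (us @ ks)"
    using t last_conv_nth[of "us @ ks"] by (cases "us @ ks = []"; simp)+
qed

text \<open>A root of in-degree 0 cannot be a split node of in-degree at least 2, so the root is
  \<open>Top\<close>. An inner node of least label would then contradict
  \<open>root_if_least_var\<close>.\<close>

lemma inner_empty_if_us_Nil:
  assumes "us = []"
  shows "inner Z = {}" "zs = []" "ks = []"
proof -
  show zs: "zs = []"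
    using indeg_zs trail_start[OF trail] ordered_diagramD(3)[OF ordered] assms
    by (cases "zs = []") auto
  then show "ks = []"
    using length' by simp
  have root: "root_node Z = Top"
    using trail zs assms by simp
  show "inner Z = {}"
  proof (rule ccontr)
    assume ne: "inner Z \<noteq> {}"
    have "root_node Z = Inner (arg_min_on (var Z) (inner Z))"
      using ordered arg_min_if_finite(1)[OF fin ne] arg_min_least[OF fin ne]
      by (rule root_if_least_var)
    then show False
      using root by simp
  qed
qed

lemma ordered': "ordered_diagram n Z'"
proof (cases "us = []")
  case True
  then show ?thesis
    using inner_empty_if_us_Nil[OF True] inner' trail'
    by (intro ordered_diagramI) (auto simp: nodes_def)
next
  case False
  have root: "root_node Z = Inner (hd us)" "root_node Z' = Inner (hd us)"
    using trail_start[OF trail] False root' by auto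
  have hd_us: "hd us \<in> set (us @ ks)"
    using False by simp
  have child_Z: "child Z i h \<noteq> Inner (hd us)" if "i \<in> inner Z" for i h
    using ordered_diagramD(3)[OF ordered] that root by (simp add: indeg_eq_0_iff[OF fin])
  obtain c where tr_us: "trail e Z A (root_node Z) us c" and tr_zs: "trail e Z A c zs Top"
    using trail by (auto simp: trail_append)
  show ?thesis
  proof (rule ordered_diagramI)
    show "finite (inner Z')"
      using fin inner' by simp
    show "root_node Z' \<in> nodes Z'"
      using root ordered_diagramD(2)[OF ordered] nodes' by simp
    show "child Z' i h \<noteq> root_node Z'" if "i \<in> inner Z'" for i h
      using that
    proof (cases rule: child'_cases[of i h])
      case on
      then obtain t where t: "t < length (us @ ks)" "i = (us @ ks) ! t"
        by (metis in_set_conv_nth)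
      have "(us @ ks) ! Suc t \<noteq> (us @ ks) ! 0" if "Suc t < length (us @ ks)"
        using nth_eq_iff_index_eq[OF distinct' that, of 0] False by simp
      moreover have "(us @ ks) ! 0 = hd us"
        using False by (simp add: nth_append hd_conv_nth)
      ultimately show ?thesis
        using trail'_nth[OF t(1)] root on(3) by (auto simp only: t(2) node.inject node.distinct split: if_splits)
    next
      case (old k)
      then show ?thesis
        using child_Z root by simp
    qed
    show "var Z' i \<in> {1..n}" if "i \<in> inner Z'" for i
      using that ordered_diagramD(5,6)[OF ordered]
      by (cases rule: child'_cases[of i True]) (use follow'(2) in auto)
    show "child Z' i h \<in> nodes Z' \<and> var Z' i < level n Z' (child Z' i h)" if "i \<in> inner Z'" for i h
      using that
    proof (cases rule: child'_cases[of i h])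
      case on
      then show ?thesis
        using follow'[of i] by simp
    next
      case (old k)
      then show ?thesis
        using ordered_diagramD(7,8)[OF ordered, of k h] nodes' level' by simp
    qed
    show "\<exists>j\<in>inner Z'. \<exists>h. child Z' j h = Inner i" if i: "i \<in> inner Z'" "root_node Z' \<noteq> Inner i" for i
    proof (cases "i \<in> set ks")
      case True
      then obtain t where t: "t < length (us @ ks)" "i = (us @ ks) ! t"
        by (metis Un_iff in_set_conv_nth set_append)
      \<comment> \<open>Position 0 is the root because \<open>us\<close> is nonempty, so a copy has
        a predecessor on the new path.\<close>
      then obtain s where s: "t = Suc s"
        using i(2) root False by (cases t) (auto simp: nth_append hd_conv_nth)
      have "follow e Z' A ((us @ ks) ! s) = Inner i"
        using trail'_nth[of s] t s by simp
      moreover have "(us @ ks) ! s \<in> inner Z'"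
        using nth_mem[of s "us @ ks"] t s on_trail(1) inner' by auto
      ultimately show ?thesis
        by (auto simp: follow_def)
    next
      case notin: False
      then have iZ: "i \<in> inner Z"
        using i inner' by simp
      \<comment> \<open>Redirection takes away a single edge. Were it the only one into
        \<open>i\<close>, then \<open>i\<close> would be the split node, which has in-degree at
        least 2.\<close>
      have "\<exists>j\<in>inner Z. \<exists>h. child Z j h = Inner i \<and> (j \<noteq> last us \<or> h \<noteq> (e (var Z j) \<in> A))"
      proof (rule ccontr)
        assume none: "\<not> ?thesis"
        have only: "j = last us \<and> h = (e (var Z (last us)) \<in> A)"
          if "j \<in> inner Z" "child Z j h = Inner i" for j h
          using none that by blast
        obtain j h where j: "j \<in> inner Z" "child Z j h = Inner i"
          using ordered_diagramD(4)[OF ordered iZ] i(2) root by (auto simp: indeg_eq_0_iff[OF fin])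
        then have "follow e Z A (last us) = Inner i"
          using only by (auto simp: follow_def)
        moreover have "follow e Z A (last us) = (if zs = [] then Top else Inner (hd zs))"
          using trail_nth[OF tr_us, of "length us - 1"] trail_start[OF tr_zs] False
          by (simp add: last_conv_nth)
        ultimately have "2 \<le> indeg Z (Inner i)"
          using indeg_zs by (auto split: if_splits)
        moreover have "indeg Z (Inner i) \<le> 1"
          unfolding indeg_le_1_iff[OF fin] using only by metis
        ultimately show False
          by simp
      qed
      then obtain j h where "j \<in> inner Z" "child Z j h = Inner i"
        "j \<noteq> last us \<or> h \<noteq> (e (var Z j) \<in> A)"
        by blast
      then show ?thesis
        using child'[of j h] inner' by auto
    qed
  qed
qed

lemma accepts':
  assumes "accepts n e Z A"
  shows "accepts n e Z' B \<longleftrightarrow> accepts n e Z B \<and> (\<exists>j\<in>{1..n}. (e j \<in> A) \<noteq> (e j \<in> B))"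
proof -
  \<comment> \<open>\<open>?S\<close> contains the recorded nodes \<open>zs\<close>: the originals
    keep their edges. It is closed under children because edges into \<open>us\<close> start in
    \<open>us\<close> and follow \<open>A\<close>.\<close>
  let ?S = "nodes Z - Inner ` set us"
  obtain u where tr_us: "trail e Z A (root_node Z) us u"
    using trail by (auto simp: trail_append)
  have off_S: "child Z i h \<in> ?S" if "i \<in> inner Z" "i \<notin> set us \<or> h \<noteq> (e (var Z i) \<in> A)" for i h
    using child_into_trail[OF ordered tr_us indeg_us _ that(1), of _ h] that
      ordered_diagramD(7)[OF ordered that(1)] by auto
  have S: "var Z' i = var Z i \<and> child Z' i h = child Z i h \<and> child Z i h \<in> ?S" if "Inner i \<in> ?S" for i h
  proof -
    have i: "i \<in> inner Z" "i \<notin> set us"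
      using that by (auto simp: nodes_def)
    moreover from this have "us = [] \<or> i \<noteq> last us"
      by auto
    ultimately show ?thesis
      using var' child'[of i h] off_S by auto
  qed
  have "accepts_from n e Z' B 0 (root_node Z') \<longleftrightarrow>
      accepts_from n e Z B 0 (root_node Z) \<and> (\<exists>j\<in>{0<..n}. (e j \<in> A) \<noteq> (e j \<in> B))"
  proof (rule accepts_from_twins[OF ordered trail trail' twins])
    show "set (us @ zs) \<subseteq> inner Z"
      using on_trail by simp
    show "accepts_from n e Z' B l (child Z i (e (var Z i) \<notin> A)) \<longleftrightarrow>
        accepts_from n e Z B l (child Z i (e (var Z i) \<notin> A))" if "i \<in> set (us @ zs)" for i l
      by (rule accepts_from_cong[OF off_S S]) (use that on_trail in auto)
    show "accepts_from n e Z A 0 (root_node Z)"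
      using assms by (simp add: accepts_iff)
    show "0 < level n Z (root_node Z)"
      by (rule level_root_pos[OF ordered])
  qed
  moreover have "{0<..n} = {1..n}"
    by auto
  ultimately show ?thesis
    by (simp add: accepts_iff)
qed

lemma size': "zdd_size Z' = zdd_size Z + 3 * length zs"
proof -
  have "card (inner Z') = card (inner Z) + card (set ks)"
    unfolding inner' using fin fresh by (intro card_Un_disjoint) auto
  then show ?thesis
    using fin inner' distinct_card[OF distinct_ks] length' by (simp add: zdd_size_eq)
qed

text \<open>The new path of \<open>A\<close> can serve as \<open>P\<close> in
  \<open>suppress_all\<close>.\<close>

lemma suppress':
  "\<exists>k Z''. k \<le> n \<and> (suppress_step ^^ k) Z' Z'' \<and> zdd n Z'' \<and>
    (\<forall>B. accepts n e Z'' B \<longleftrightarrow> accepts n e Z' B) \<and> zdd_size Z'' \<le> zdd_size Z'"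
proof -
  have "card (set (us @ ks)) \<le> n"
    using distinct_card[OF distinct'] on_trail(4) length' by simp
  moreover have "\<exists>k Z''. k \<le> card (set (us @ ks)) \<and> (suppress_step ^^ k) Z' Z'' \<and> zdd n Z'' \<and>
      (\<forall>B. accepts n e Z'' B \<longleftrightarrow> accepts n e Z' B) \<and> zdd_size Z'' \<le> zdd_size Z'"
  proof (rule suppress_all[OF ordered'])
    show "set (us @ ks) \<subseteq> inner Z'"
      using on_trail(1) inner' by auto
    show "i \<in> set (us @ ks)" if "i \<in> inner Z'" "hi Z' i = Bot" for i
      using last_in_set[OF hi_Bot'(2)[OF that]] hi_Bot'(3)[OF that] by simp
  qed (use child_into_trail' indeg' in auto)
  ultimately show ?thesis
    by (meson le_trans)
qed

end

section \<open>Termination and outcome of the loops\<close>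

section \<open>Running RestrictSet\<close>

text \<open>The start node, the recorded parent and the counter vary so that the induction can
  follow the loop.\<close>

lemma find_split_while:
  assumes "trail e Z A a us c" "\<And>i. i \<in> set us \<Longrightarrow> indeg Z (Inner i) < 2"
    and "\<not> (indeg Z c < 2 \<and> c \<notin> {Top, Bot})"
  shows "while_option
      (\<lambda>(a, b, t). indeg Z a < 2 \<and> a \<notin> {Top, Bot})
      (\<lambda>(a, b, t). case a of Inner i \<Rightarrow> (follow e Z A i, Some i, t + 1) | _ \<Rightarrow> (a, b, t))
      (a, b, t) = Some (c, if us = [] then b else Some (last us), t + length us)"
  using assms(1,2)
proof (induction us arbitrary: a b t)
  case Nil
  then show ?case
    using assms(3) by (subst while_option_unfold) auto
next
  case (Cons i us)
  then show ?case
    by (subst while_option_unfold) simp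
qed

lemma record_path_while:
  assumes "trail e Z A a zs Top"
  shows "while_option
      (\<lambda>(a, xs, t). a \<notin> {Top, Bot})
      (\<lambda>(a, xs, t). case a of Inner i \<Rightarrow> (follow e Z A i, xs @ [i], t + 1) | _ \<Rightarrow> (a, xs, t))
      (a, xs, t) = Some (Top, xs @ zs, t + length zs)"
  using assms
proof (induction zs arbitrary: a xs t)
  case Nil
  then show ?case
    by (subst while_option_unfold) simp
next
  case (Cons i zs)
  then show ?case
    by (subst while_option_unfold) simp
qed

lemma Least_fresh: "finite (inner Z) \<Longrightarrow> (LEAST k. k \<notin> inner Z) \<notin> inner Z"
  by (rule LeastI_ex) (rule ex_new_if_finite[OF infinite_UNIV_nat])

text \<open>Described through \<open>child\<close>, the two branches of the procedure coincide: the
  edge along \<open>A\<close> goes to \<open>a\<close>, the other one is copied.\<close>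

lemma copy_node_facts:
  assumes "copy_node e A i (Z, a, t) = (Z', a', t')" "finite (inner Z)"
  obtains k where "k \<notin> inner Z" "a' = Inner k" "t' = t + 1" "inner Z' = insert k (inner Z)"
    "root_node Z' = root_node Z"
    "\<And>j. var Z' j = (if j = k then var Z i else var Z j)"
    "\<And>j h. child Z' j h =
      (if j = k then if h = (e (var Z i) \<in> A) then a else child Z i h else child Z j h)"
proof (rule that[of "LEAST k. k \<notin> inner Z"])
qed (use assms Least_fresh in
  \<open>auto simp: copy_node_def insert_node_def Let_def child_def split: if_splits\<close>)

text \<open>The list is processed from its end, so the chain grows backwards from
  \<open>Bot\<close>, each copy being put in front of \<open>ks\<close>.\<close>

lemma fold_copy_node:
  assumes "finite (inner Z)" "set zs \<subseteq> inner Z"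
  obtains Z' ks where
    "fold (copy_node e A) (rev zs) (Z, Bot, 0) = (Z', if ks = [] then Bot else Inner (hd ks), length zs)"
    "inner Z' = inner Z \<union> set ks" "set ks \<inter> inner Z = {}" "distinct ks" "root_node Z' = root_node Z"
    "\<And>i. i \<in> inner Z \<Longrightarrow> var Z' i = var Z i"
    "\<And>i h. i \<in> inner Z \<Longrightarrow> child Z' i h = child Z i h"
    "trail e Z' A (if ks = [] then Bot else Inner (hd ks)) ks Bot"
    "list_all2 (twin e Z Z' A) zs ks"
  using assms(2)
proof (induction zs arbitrary: thesis)
  case Nil
  show ?case
    by (rule Nil.prems(1)[of Z "[]"]) auto
next
  case (Cons i zs)
  obtain Z1 ks where IH:
    "fold (copy_node e A) (rev zs) (Z, Bot, 0) = (Z1, if ks = [] then Bot else Inner (hd ks), length zs)"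
    "inner Z1 = inner Z \<union> set ks" "set ks \<inter> inner Z = {}" "distinct ks" "root_node Z1 = root_node Z"
    "\<And>i. i \<in> inner Z \<Longrightarrow> var Z1 i = var Z i"
    "\<And>i h. i \<in> inner Z \<Longrightarrow> child Z1 i h = child Z i h"
    "trail e Z1 A (if ks = [] then Bot else Inner (hd ks)) ks Bot"
    "list_all2 (twin e Z Z1 A) zs ks"
    using Cons.IH Cons.prems(2) by auto
  define a where "a = (if ks = [] then Bot else Inner (hd ks))"
  obtain Z2 a2 t2 where copy: "copy_node e A i (Z1, a, length zs) = (Z2, a2, t2)"
    by (metis prod_cases3)
  have "finite (inner Z1)"
    using assms(1) IH(2) by simp
  with copy obtain k where k: "k \<notin> inner Z1" "a2 = Inner k" "t2 = length zs + 1"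
    "inner Z2 = insert k (inner Z1)" "root_node Z2 = root_node Z1"
    "\<And>j. var Z2 j = (if j = k then var Z1 i else var Z1 j)"
    "\<And>j h. child Z2 j h =
      (if j = k then if h = (e (var Z1 i) \<in> A) then a else child Z1 i h else child Z1 j h)"
    by (rule copy_node_facts) blast
  have i: "i \<in> inner Z"
    using Cons.prems(2) by simp
  have k_fresh: "k \<notin> inner Z" "k \<notin> set ks"
    using k(1) IH(2) by auto
  show ?case
  proof (rule Cons.prems(1)[of Z2 "k # ks"])
    show "fold (copy_node e A) (rev (i # zs)) (Z, Bot, 0) =
        (Z2, if k # ks = [] then Bot else Inner (hd (k # ks)), length (i # zs))"
      using IH(1) copy k(2,3) by (simp add: a_def)
    show "inner Z2 = inner Z \<union> set (k # ks)" "set (k # ks) \<inter> inner Z = {}" "distinct (k # ks)"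
      "root_node Z2 = root_node Z"
      using IH(2-5) k(4,5) k_fresh by auto
    show "var Z2 j = var Z j" "child Z2 j h = child Z j h" if "j \<in> inner Z" for j h
      using that k(6,7) k_fresh IH(6,7) by auto
    \<comment> \<open>\<open>k\<close> is none of the earlier copies, so their chain to
      \<open>Bot\<close> is intact.\<close>
    have "trail e Z2 A a ks Bot"
      using IH(8) k(6,7) k_fresh unfolding a_def
      by (elim trail_cong) (auto simp: follow_def)
    then show "trail e Z2 A (if k # ks = [] then Bot else Inner (hd (k # ks))) (k # ks) Bot"
      using k(6,7) by (simp add: follow_def)
    have "list_all2 (twin e Z Z2 A) zs ks"
      using IH(9) k_fresh k(6,7)
      by (elim list.rel_mono_strong) (auto simp: twin_def)
    moreover have "twin e Z Z2 A i k"
      using i IH(6,7) k(6,7) by (auto simp: twin_def)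
    ultimately show "list_all2 (twin e Z Z2 A) (i # zs) (k # ks)"
      by simp
  qed
qed

lemma redirect_simps:
  "inner (redirect i g v Z) = inner Z" "var (redirect i g v Z) = var Z"
  "root_node (redirect i g v Z) = root_node Z"
  "child (redirect i g v Z) j h = (if j = i \<and> h = g then v else child Z j h)"
  by (auto simp: redirect_def child_def)

lemma restrict_set_reroute:
  assumes zdd: "zdd n Z" and acc: "accepts n e Z A"
  obtains Z' us zs ks where "reroute n e Z Z' A us zs ks"
    "restrict_set e Z A = Some (Z', length us + 2 * length zs + 1)"
proof -
  have ord: "ordered_diagram n Z"
    using zdd by (simp add: zdd_def)
  obtain xs where xs: "trail e Z A (root_node Z) xs Top"
    using acc accepts_from_trail unfolding accepts_iff by blast
  have xs_inner: "set xs \<subseteq> inner Z" and "distinct xs"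
    using trail_ordered[OF ord xs ordered_diagramD(2)[OF ord]] by auto
  \<comment> \<open>The path is cut by the loop condition of \<open>find_split\<close>:
    \<open>zs\<close> starts at the first node of in-degree at least 2 and is empty if the search
    reaches \<open>Top\<close>.\<close>
  define us where "us = takeWhile (\<lambda>i. indeg Z (Inner i) < 2) xs"
  define zs where "zs = dropWhile (\<lambda>i. indeg Z (Inner i) < 2) xs"
  have xs_eq: "xs = us @ zs"
    by (simp add: us_def zs_def)
  have indeg_us: "indeg Z (Inner i) < 2" if "i \<in> set us" for i
    using that set_takeWhileD by (fastforce simp: us_def)
  have indeg_zs: "2 \<le> indeg Z (Inner (hd zs))" if "zs \<noteq> []"
    using that hd_dropWhile[of "\<lambda>i. indeg Z (Inner i) < 2" xs] by (simp add: zs_def)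
  obtain c where tr_us: "trail e Z A (root_node Z) us c" and tr_zs: "trail e Z A c zs Top"
    using xs by (auto simp: xs_eq trail_append)
  have c: "c = (if zs = [] then Top else Inner (hd zs))"
    using trail_start[OF tr_zs] .
  obtain Z1 ks where copy:
    "fold (copy_node e A) (rev zs) (Z, Bot, 0) = (Z1, if ks = [] then Bot else Inner (hd ks), length zs)"
    "inner Z1 = inner Z \<union> set ks" "set ks \<inter> inner Z = {}" "distinct ks" "root_node Z1 = root_node Z"
    "\<And>i. i \<in> inner Z \<Longrightarrow> var Z1 i = var Z i"
    "\<And>i h. i \<in> inner Z \<Longrightarrow> child Z1 i h = child Z i h"
    "trail e Z1 A (if ks = [] then Bot else Inner (hd ks)) ks Bot"
    "list_all2 (twin e Z Z1 A) zs ks"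
    using fold_copy_node[OF ordered_diagramD(1)[OF ord], of zs e A] xs_inner xs_eq by auto
  define a where "a = (if ks = [] then Bot else Inner (hd ks))"
  define Z' where "Z' = (if us = [] then Z1\<lparr>root_node := a\<rparr>
    else redirect (last us) (e (var Z1 (last us)) \<in> A) a Z1)"
  have Z': "inner Z' = inner Z1" "var Z' = var Z1"
    "root_node Z' = (if us = [] then a else root_node Z1)"
    "child Z' i h = (if us \<noteq> [] \<and> i = last us \<and> h = (e (var Z1 (last us)) \<in> A) then a else child Z1 i h)"
    for i h
    by (auto simp: Z'_def redirect_simps) (simp_all add: child_def)
  have last_us: "us \<noteq> [] \<Longrightarrow> last us \<in> inner Z"
    using xs_inner xs_eq by auto
  have last_ks: "us \<noteq> [] \<Longrightarrow> last us \<notin> set ks"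
    using last_us copy(3) by auto
  have "find_split e Z A = Some (c, if us = [] then None else Some (last us), length us)"
    unfolding find_split_def using find_split_while[OF tr_us indeg_us, of None 0] indeg_zs c
    by (auto split: if_splits)
  moreover have "record_path e Z A c = Some (Top, zs, length zs)"
    unfolding record_path_def using record_path_while[OF tr_zs, of "[]" 0] by simp
  \<comment> \<open>The search costs one step per node of \<open>us\<close>, recording and copying
    cost two per node of \<open>zs\<close>, and the redirection costs one.\<close>
  ultimately have "restrict_set e Z A = Some (Z', length us + 2 * length zs + 1)"
    by (simp add: restrict_set_def copy(1) Z'_def a_def)
  moreover have "reroute n e Z Z' A us zs ks"
  proof
    show "zdd n Z" "trail e Z A (root_node Z) (us @ zs) Top"
      using zdd xs xs_eq by auto
    show "indeg Z (Inner i) \<le> 1" if "i \<in> set us" for i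
      using indeg_us[OF that] by simp
    show "zs \<noteq> [] \<Longrightarrow> 2 \<le> indeg Z (Inner (hd zs))"
      by (rule indeg_zs)
    show "inner Z' = inner Z \<union> set ks" "set ks \<inter> inner Z = {}" "distinct ks"
      using copy(2-4) Z' by auto
    show "var Z' i = var Z i" if "i \<in> inner Z" for i
      using copy(6) that Z' by auto
    show "child Z' i h = child Z i h"
      if "i \<in> inner Z" "us = [] \<or> i \<noteq> last us \<or> h \<noteq> (e (var Z i) \<in> A)" for i h
      using that copy(6,7) Z'(4)[of i h] by auto
    show "us \<noteq> [] \<Longrightarrow> root_node Z' = root_node Z"
      using Z' copy(5) by simp
    show "list_all2 (twin e Z Z' A) zs ks"
      using copy(9) last_ks
      by (elim list.rel_mono_strong) (auto simp: twin_def Z')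
    have tr_ks: "trail e Z' A a ks Bot"
      using copy(8) last_ks unfolding a_def
      by (elim trail_cong) (auto simp: follow_def Z')
    show "trail e Z' A (root_node Z') (us @ ks) Bot"
    proof (cases us rule: rev_cases)
      case Nil
      then show ?thesis
        using tr_ks Z' by simp
    next
      case (snoc us' b)
      \<comment> \<open>Only the edge of \<open>b\<close> along \<open>A\<close> is redirected and
        \<open>b\<close> is not in \<open>us'\<close>, so the path up to \<open>b\<close> survives
        and then enters the chain of copies.\<close>
      have "trail e Z A (root_node Z) us' (Inner b)"
        using tr_us snoc by (auto simp: trail_append)
      moreover have "b \<notin> set us'" "set us' \<subseteq> inner Z"
        using \<open>distinct xs\<close> xs_inner xs_eq snoc by auto
      ultimately have "trail e Z' A (root_node Z) us' (Inner b)"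
        using copy(6,7) by (elim trail_cong) (auto simp: follow_def Z' snoc subset_iff)
      moreover have "follow e Z' A b = a"
        by (simp add: follow_def Z' snoc)
      ultimately show ?thesis
        using tr_ks Z'(3) copy(5) snoc by (auto simp: trail_append)
    qed
  qed
  ultimately show ?thesis
    using that by blast
qed

section \<open>Step count, structure, accepted sets and size combined\<close>

theorem theorem1:
  "\<exists>T :: nat \<Rightarrow> nat. (\<lambda>n. real (T n)) \<in> O(\<lambda>n. real n) \<and>
    (\<forall>n (e :: nat \<Rightarrow> 'a) F Z A.
       inj_on e {1..n} \<longrightarrow> F \<subseteq> Pow (e ` {1..n}) \<longrightarrow>
       zdd n Z \<longrightarrow> characterizes n e Z F \<longrightarrow> A \<in> F \<longrightarrow>
       (\<exists>Z' t. restrict_set e Z A = Some (Z', t) \<and> t \<le> T n \<and>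
          ordered_diagram n Z' \<and>
          (\<forall>i\<in>inner Z'. hi Z' i = Bot \<longrightarrow>
             e (var Z' i) \<in> A \<and> (\<exists>p. path e Z' A (root_node Z') (p @ [Inner i, Bot]))) \<and>
          characterizes n e Z' (F - {A}) \<and>
          zdd_size Z' \<le> zdd_size Z + 3 * n \<and>
          (\<exists>k Z''. t + k \<le> T n \<and> (suppress_step ^^ k) Z' Z'' \<and>
             zdd n Z'' \<and> characterizes n e Z'' (F - {A}) \<and>
             zdd_size Z'' \<le> zdd_size Z + 3 * n)))"
proof (intro exI[of _ "\<lambda>n. 3 * n + 1"] conjI allI impI)
  \<comment> \<open>For \<open>n\<close> at least 1, \<open>3 * n + 1\<close> is at most
    \<open>4 * n\<close>.\<close>
  show "(\<lambda>n. real (3 * n + 1)) \<in> O(\<lambda>n. real n)"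
    by (intro bigoI[of _ 4] eventually_sequentiallyI[of 1]) simp
next
  fix n :: nat and e :: "nat \<Rightarrow> 'a" and F Z A
  assume F: "F \<subseteq> Pow (e ` {1..n})" and zdd: "zdd n Z" and char: "characterizes n e Z F"
    and A: "A \<in> F"
  have A': "A \<subseteq> e ` {1..n}" "accepts n e Z A"
    using A char by (auto simp: characterizes_def)
  obtain Z' us zs ks where "reroute n e Z Z' A us zs ks"
    and run: "restrict_set e Z A = Some (Z', length us + 2 * length zs + 1)"
    using restrict_set_reroute[OF zdd A'(2)] .
  interpret reroute n e Z Z' A us zs ks
    by fact
  \<comment> \<open>Subsets of the ground set differ exactly when some index tells them apart, so
    the condition in \<open>accepts'\<close> removes \<open>A\<close> and nothing else.\<close>
  have "(\<exists>j\<in>{1..n}. (e j \<in> A) \<noteq> (e j \<in> B)) \<longleftrightarrow> B \<noteq> A" if "B \<subseteq> e ` {1..n}" for B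
    using that A'(1) by blast
  then have char': "characterizes n e Z' (F - {A})"
    using char accepts'[OF A'(2)] by (auto simp: characterizes_def)
  have path': "\<exists>p. path e Z' A (root_node Z') (p @ [Inner i, Bot])"
    if "i \<in> inner Z'" "hi Z' i = Bot" for i
  proof
    have "us @ ks = butlast (us @ ks) @ [i]"
      using hi_Bot'[OF that] by simp
    then have "map Inner (us @ ks) @ [Bot] = map Inner (butlast (us @ ks)) @ [Inner i, Bot]"
      by (metis append.assoc append_Cons append_Nil list.simps(8,9) map_append)
    then show "path e Z' A (root_node Z') (map Inner (butlast (us @ ks)) @ [Inner i, Bot])"
      using trail_path[OF trail'] by simp
  qed
  obtain k Z'' where Z'': "k \<le> n" "(suppress_step ^^ k) Z' Z''" "zdd n Z''"
    "\<forall>B. accepts n e Z'' B \<longleftrightarrow> accepts n e Z' B" "zdd_size Z'' \<le> zdd_size Z'"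
    using suppress' by blast
  have char'': "characterizes n e Z'' (F - {A})"
    using char' Z''(4) by (simp add: characterizes_def)
  have len: "length us + length zs \<le> n"
    using on_trail(4) by simp
  have size: "zdd_size Z' \<le> zdd_size Z + 3 * n" "zdd_size Z'' \<le> zdd_size Z + 3 * n"
    using size' Z''(5) len by linarith+
  \<comment> \<open>\<open>us\<close> and \<open>zs\<close> together have at most \<open>n\<close>
    nodes, so the procedure takes at most \<open>2 * n + 1\<close> steps; up to \<open>n\<close>
    deletions may follow.\<close>
  have steps: "length us + 2 * length zs + 1 \<le> 3 * n + 1" "length us + 2 * length zs + 1 + k \<le> 3 * n + 1"
    using len Z''(1) by linarith+
  have suppressed: "\<exists>k Z''. length us + 2 * length zs + 1 + k \<le> 3 * n + 1 \<and>
      (suppress_step ^^ k) Z' Z'' \<and> zdd n Z'' \<and> characterizes n e Z'' (F - {A}) \<and>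
      zdd_size Z'' \<le> zdd_size Z + 3 * n"
    by (rule exI[of _ k], rule exI[of _ Z''], intro conjI) (fact steps Z'' char'' size)+
  show "\<exists>Z' t. restrict_set e Z A = Some (Z', t) \<and> t \<le> 3 * n + 1 \<and>
      ordered_diagram n Z' \<and>
      (\<forall>i\<in>inner Z'. hi Z' i = Bot \<longrightarrow>
         e (var Z' i) \<in> A \<and> (\<exists>p. path e Z' A (root_node Z') (p @ [Inner i, Bot]))) \<and>
      characterizes n e Z' (F - {A}) \<and>
      zdd_size Z' \<le> zdd_size Z + 3 * n \<and>
      (\<exists>k Z''. t + k \<le> 3 * n + 1 \<and> (suppress_step ^^ k) Z' Z'' \<and>
         zdd n Z'' \<and> characterizes n e Z'' (F - {A}) \<and>
         zdd_size Z'' \<le> zdd_size Z + 3 * n)"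
  proof (rule exI[of _ Z'], rule exI[of _ "length us + 2 * length zs + 1"], intro conjI ballI impI)
    show "restrict_set e Z A = Some (Z', length us + 2 * length zs + 1)"
      by (rule run)
    show "e (var Z' i) \<in> A" "\<exists>p. path e Z' A (root_node Z') (p @ [Inner i, Bot])"
      if "i \<in> inner Z'" "hi Z' i = Bot" for i
      using that by (rule hi_Bot'(1), rule path')
  qed (fact ordered' char' size steps suppressed)+
qed

end
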